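(* Let $n,m\in\mathbb{N}$, let $K\subset\mathbb{R}^n$ be a compact set, and let $p:\mathbb{R}\to\mathbb{R}$ be a non-affine polynomial. Then $$\overline{\mathcal{DM}^{p}_{n,m,n+m+1}}=C(K,\mathbb{R}^m).$$
   Context: $\mathbb{N}=\{1,2,\dots\}$; $C(K,\mathbb{R}^m)$ is the set of continuous functions from $K$ to $\mathbb{R}^m$. For an activation function $\sigma:\mathbb{R}\to\mathbb{R}$ (applied componentwise), $\mathcal{DM}^{\sigma}_{l,l',w}$ is the set of deep narrow multilayer perceptrons: all functions $C_N\circ\sigma\circ C_{N-1}\circ\cdots\circ\sigma\circ C_1:\mathbb{R}^{l}\to\mathbb{R}^{l'}$, where $N\in\mathbb{N}$ is arbitrary, $l_0=l$, $l_N=l'$, $l_1,\dots,l_{N-1}\in\{1,\dots,w\}$ are arbitrary widths, and each $C_i:\mathbb{R}^{l_{i-1}}\to\mathbb{R}^{l_i}$ is affine, $C_i(x)=A_ix+b_i$ with $A_i\in\mathbb{R}^{l_i\times l_{i-1}}$, $b_i\in\mathbb{R}^{l_i}$. Functions are restricted to $K$, and the overline denotes closure in $C(K,\mathbb{R}^m)$ with respect to the uniform norm $\|f\|_{\infty,K}=\sup_{x\in K}\|f(x)\|_\infty$. *)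

theory Defs
  imports "HOL-Analysis.Analysis" "HOL-Computational_Algebra.Polynomial"
begin

section \<open>Deep narrow multilayer perceptrons\<close>

text \<open>
  Hidden widths vary within a single network, so a hidden vector in \<open>\<real>\<^sup>l\<close> is represented by
  a function \<^typ>\<open>nat \<Rightarrow> real\<close> of which only the coordinates in \<open>{..<l}\<close> are ever read.
  The index sets of input and output are the finite types \<open>'n\<close> and \<open>'m\<close>; \<open>affine_layer\<close>
  is polymorphic in both index types so that it covers all layers.
\<close>

definition affine_layer ::
  "'j set \<Rightarrow> ('i \<Rightarrow> 'j \<Rightarrow> real) \<Rightarrow> ('i \<Rightarrow> real) \<Rightarrow> ('j \<Rightarrow> real) \<Rightarrow> 'i \<Rightarrow> real" where
  "affine_layer J A b x = (\<lambda>i. (\<Sum>j\<in>J. A i j * x j) + b i)"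

text \<open>
  \<open>(l, f) \<in> hidden_maps \<sigma> w\<close> iff \<open>f = C\<^sub>k \<circ> \<sigma> \<circ> C\<^sub>k\<^sub>-\<^sub>1 \<circ> \<dots> \<circ> \<sigma> \<circ> C\<^sub>1\<close> for some \<open>k \<ge> 1\<close> and affine
  \<open>C\<^sub>1, \<dots>, C\<^sub>k\<close> whose output dimensions all lie in \<open>{1..w}\<close>, that of \<open>C\<^sub>k\<close> being \<open>l\<close>.
  The activation following \<open>C\<^sub>k\<close> is not included.
\<close>

inductive_set hidden_maps ::
  "(real \<Rightarrow> real) \<Rightarrow> nat \<Rightarrow> (nat \<times> (real ^ 'n \<Rightarrow> nat \<Rightarrow> real)) set"
  for \<sigma> :: "real \<Rightarrow> real" and w :: nat where
  first: "l \<in> {1..w} \<Longrightarrow> (l, \<lambda>x. affine_layer UNIV A b (($) x)) \<in> hidden_maps \<sigma> w"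
| step: "(l, f) \<in> hidden_maps \<sigma> w \<Longrightarrow> l' \<in> {1..w} \<Longrightarrow>
    (l', \<lambda>x. affine_layer {..<l} A b (\<lambda>j. \<sigma> (f x j))) \<in> hidden_maps \<sigma> w"

text \<open>The two parts are the networks with \<open>N = 1\<close> (no hidden layer) and with \<open>N \<ge> 2\<close>.\<close>

definition deep_narrow_mlps :: "(real \<Rightarrow> real) \<Rightarrow> nat \<Rightarrow> (real ^ 'n \<Rightarrow> real ^ 'm) set" where
  "deep_narrow_mlps \<sigma> w =
     {\<lambda>x. A *v x + b | A b. True} \<union>
     {\<lambda>x. vec_lambda (affine_layer {..<l} A b (\<lambda>j. \<sigma> (f x j))) | l f A b.
        (l, f) \<in> hidden_maps \<sigma> w}"


section \<open>Continuous functions with the uniform norm\<close>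

definition infnorm_metric :: "(real ^ 'm) metric" where
  "infnorm_metric = metric (UNIV, \<lambda>x y. infnorm (x - y))"

text \<open>Functions on \<open>K\<close> are represented by their extensional representatives.\<close>

definition C_on :: "(real ^ 'n) set \<Rightarrow> (real ^ 'n \<Rightarrow> real ^ 'm) set" where
  "C_on K = {f \<in> extensional K. continuous_on K f}"

abbreviation unif_metric :: "(real ^ 'n) set \<Rightarrow> (real ^ 'n \<Rightarrow> real ^ 'm) metric" where
  "unif_metric K \<equiv> cfunspace (top_of_set K) infnorm_metric"

text \<open>
  The lemmas below confirm that for compact \<open>K\<close> the metric space \<^term>\<open>unif_metric K\<close> is
  \<^term>\<open>C_on K\<close> with the metric of the uniform norm.
\<close>

lemma Metric_space_infnorm: "Metric_space UNIV (\<lambda>x y :: real ^ 'm. infnorm (x - y))"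
proof
  fix x y z :: "real ^ 'm"
  show "0 \<le> infnorm (x - y)" by (rule infnorm_pos_le)
  show "infnorm (x - y) = infnorm (y - x)" by (rule infnorm_sub)
  show "infnorm (x - y) = 0 \<longleftrightarrow> x = y" by (simp add: infnorm_eq_0)
  show "infnorm (x - z) \<le> infnorm (x - y) + infnorm (y - z)"
    using infnorm_triangle[of "x - y" "y - z"] by simp
qed

lemma mspace_infnorm_metric [simp]: "mspace infnorm_metric = UNIV"
  by (simp add: infnorm_metric_def Metric_space.mspace_metric[OF Metric_space_infnorm])

lemma mdist_infnorm_metric [simp]: "mdist infnorm_metric = (\<lambda>x y. infnorm (x - y))"
  by (simp add: infnorm_metric_def Metric_space.mdist_metric[OF Metric_space_infnorm])

lemma mtopology_of_infnorm_metric [simp]: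
  "mtopology_of (infnorm_metric :: (real ^ 'm) metric) = euclidean"
proof -
  interpret I: Metric_space UNIV "\<lambda>x y :: real ^ 'm. infnorm (x - y)"
    by (rule Metric_space_infnorm)
  define c where "c = sqrt (DIM(real ^ 'm))"
  have c: "c > 0" by (simp add: c_def)
  have le: "norm x \<le> c * infnorm x" for x :: "real ^ 'm"
    unfolding c_def by (rule norm_le_infnorm)
  have "openin I.mtopology U \<longleftrightarrow> open U" for U
  proof
    assume U: "openin I.mtopology U"
    show "open U"
      unfolding open_contains_ball
    proof
      fix x assume "x \<in> U"
      then obtain r where r: "r > 0" "I.mball x r \<subseteq> U"
        using U unfolding I.openin_mtopology by blast
      have "ball x r \<subseteq> I.mball x r"
        using infnorm_le_norm by (fastforce simp: I.in_mball dist_norm intro: le_less_trans)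
      with r show "\<exists>e>0. ball x e \<subseteq> U" by blast
    qed
  next
    assume U: "open U"
    show "openin I.mtopology U"
      unfolding I.openin_mtopology
    proof (intro conjI allI impI)
      fix x assume "x \<in> U"
      then obtain r where r: "r > 0" "ball x r \<subseteq> U"
        using U open_contains_ball by blast
      have "I.mball x (r / c) \<subseteq> ball x r"
      proof
        fix y assume "y \<in> I.mball x (r / c)"
        then have "c * infnorm (x - y) < r"
          using c by (simp add: I.in_mball pos_less_divide_eq mult.commute)
        with le[of "x - y"] show "y \<in> ball x r" by (simp add: dist_norm)
      qed
      with r c show "\<exists>r>0. I.mball x r \<subseteq> U"
        by (intro exI[of _ "r / c"]) auto
    qed auto
  qed
  then show ?thesis
    by (simp add: mtopology_of_def topology_eq)
qed

lemma mspace_unif_metric: "compact K \<Longrightarrow> mspace (unif_metric K) = C_on K"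
  by (subst compactin_mspace_cfunspace)
    (auto simp: C_on_def compactin_subtopology)

lemma mdist_unif_metric:
  assumes "compact K" "K \<noteq> {}" "f \<in> C_on K" "g \<in> C_on K"
  shows "mdist (unif_metric K) f g = (SUP x\<in>K. infnorm (f x - g x))"
proof -
  have "f \<in> mspace (unif_metric K)" "g \<in> mspace (unif_metric K)"
    using assms by (simp_all only: mspace_unif_metric)
  then show ?thesis
    using assms cfunspace_subset_funspace[of "top_of_set K" "infnorm_metric :: (real ^ 'b) metric"]
    by (auto simp: mdist_cfunspace_eq_mdist_funspace
        Metric_space.fdist_def[OF Metric_space_infnorm] subset_iff)
qed

end

theory Submission
  imports Defs
begin

text \<open>
  The components of a layer of width \<open>n + m + 1\<close> hold the input \<open>x\<close>, an accumulator \<open>y\<close> with values in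
  \<open>\<real>\<^sup>m\<close> and one scratch value \<open>z\<close>. Near a point where \<open>p'\<close> does not vanish, \<open>p\<close> is close
  to a nonconstant affine function, so up to a uniform error a layer can apply \<open>p\<close> to \<open>z\<close> and leave
  \<open>x\<close> and \<open>y\<close> unchanged. Repeating this, a network can add any multiple of
  \<open>(p \<circ> \<dots> \<circ> p) (a \<bullet> x + b)\<close> to a coordinate of \<open>y\<close>. The functions that can be added form a
  uniformly closed linear space. The iterates of \<open>p\<close> have unbounded degree, so by forming
  differences this space contains every polynomial in \<open>a \<bullet> x\<close>, hence \<open>exp (a \<bullet> x)\<close>; the
  exponentials span an algebra that separates points.
\<close>

section \<open>Approximation by hidden layers\<close>

lemma affine_layer_affine_layer:
  "affine_layer J A b (affine_layer I A' b' x) =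
     affine_layer I (\<lambda>i k. \<Sum>j\<in>J. A i j * A' j k) (\<lambda>i. (\<Sum>j\<in>J. A i j * b' j) + b i) x"
proof
  fix i
  have "(\<Sum>j\<in>J. A i j * (\<Sum>k\<in>I. A' j k * x k)) = (\<Sum>k\<in>I. (\<Sum>j\<in>J. A i j * A' j k) * x k)"
    by (simp add: sum_distrib_left sum_distrib_right mult.assoc) (rule sum.swap)
  then show "affine_layer J A b (affine_layer I A' b' x) i =
     affine_layer I (\<lambda>i k. \<Sum>j\<in>J. A i j * A' j k) (\<lambda>i. (\<Sum>j\<in>J. A i j * b' j) + b i) x i"
    by (simp add: affine_layer_def distrib_left sum.distrib)
qed

text \<open>The last affine map of a hidden map is not yet followed by an activation, so a further
  affine map merges with it and costs no layer. This is why all bookkeeping between activations is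
  free.\<close>

lemma hidden_maps_affine:
  assumes "(l, f) \<in> hidden_maps \<sigma> w" and "l' \<in> {1..w}"
  shows "(l', \<lambda>x. affine_layer {..<l} A b (f x)) \<in> hidden_maps \<sigma> w"
  using assms(1)
proof cases
  case (first A' b')
  show ?thesis
    unfolding first(1) affine_layer_affine_layer by (rule hidden_maps.first[OF assms(2)])
next
  case (step k g A' b')
  show ?thesis
    unfolding step(1) affine_layer_affine_layer by (rule hidden_maps.step[OF step(2) assms(2)])
qed

text \<open>The values approximated are those before an activation, and the width is exactly
  \<open>w\<close>. Hence an affine map can be merged into the network or an activation appended,
  and the result again has this form.\<close>

definition approximable ::
  "(real \<Rightarrow> real) \<Rightarrow> nat \<Rightarrow> (real ^ 'n) set \<Rightarrow> (real ^ 'n \<Rightarrow> nat \<Rightarrow> real) \<Rightarrow> bool" where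
  "approximable \<sigma> w K F \<longleftrightarrow>
     (\<forall>\<epsilon>>0. \<exists>f. (w, f) \<in> hidden_maps \<sigma> w \<and> (\<forall>x\<in>K. \<forall>i<w. \<bar>f x i - F x i\<bar> < \<epsilon>))"

lemma approximable_limit:
  assumes "\<And>\<epsilon>. \<epsilon> > 0 \<Longrightarrow> \<exists>G. approximable \<sigma> w K G \<and> (\<forall>x\<in>K. \<forall>i<w. \<bar>G x i - F x i\<bar> < \<epsilon>)"
  shows "approximable \<sigma> w K F"
  unfolding approximable_def
proof (intro allI impI)
  fix \<epsilon> :: real assume "\<epsilon> > 0"
  then obtain G where G: "approximable \<sigma> w K G" "\<And>x i. x \<in> K \<Longrightarrow> i < w \<Longrightarrow> \<bar>G x i - F x i\<bar> < \<epsilon> / 2"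
    using assms[of "\<epsilon> / 2"] by auto
  then obtain f where f: "(w, f) \<in> hidden_maps \<sigma> w"
      "\<And>x i. x \<in> K \<Longrightarrow> i < w \<Longrightarrow> \<bar>f x i - G x i\<bar> < \<epsilon> / 2"
    using \<open>\<epsilon> > 0\<close> unfolding approximable_def by (meson half_gt_zero)
  have "\<bar>f x i - F x i\<bar> < \<epsilon>" if "x \<in> K" "i < w" for x i
    using f(2)[OF that] G(2)[OF that] by linarith
  with f(1) show "\<exists>f. (w, f) \<in> hidden_maps \<sigma> w \<and> (\<forall>x\<in>K. \<forall>i<w. \<bar>f x i - F x i\<bar> < \<epsilon>)"
    by blast
qed

section \<open>Affine functions of the coordinates of a layer\<close>

definition affine_feature :: "nat \<Rightarrow> ('a \<Rightarrow> nat \<Rightarrow> real) \<Rightarrow> ('a \<Rightarrow> real) \<Rightarrow> bool" where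
  "affine_feature w F g \<longleftrightarrow> (\<exists>a b. \<forall>x. g x = (\<Sum>j<w. a j * F x j) + b)"

lemma affine_feature_coordinate: "i < w \<Longrightarrow> affine_feature w F (\<lambda>x. F x i)"
  unfolding affine_feature_def
  by (intro exI[of _ "\<lambda>j. if j = i then 1 else 0"] exI[of _ 0])
    (simp add: if_distrib[of "\<lambda>u. u * _"] sum.delta cong: if_cong)

lemma affine_feature_const: "affine_feature w F (\<lambda>_. c)"
  unfolding affine_feature_def by (intro exI[of _ "\<lambda>_. 0"] exI[of _ c]) simp

lemma affine_feature_add:
  assumes "affine_feature w F g" "affine_feature w F h"
  shows "affine_feature w F (\<lambda>x. g x + h x)"
proof -
  from assms obtain a b a' b' where "\<And>x. g x = (\<Sum>j<w. a j * F x j) + b"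
      "\<And>x. h x = (\<Sum>j<w. a' j * F x j) + b'"
    unfolding affine_feature_def by blast
  then show ?thesis
    unfolding affine_feature_def
    by (intro exI[of _ "\<lambda>j. a j + a' j"] exI[of _ "b + b'"]) (simp add: distrib_right sum.distrib)
qed

lemma affine_feature_cmult:
  assumes "affine_feature w F g"
  shows "affine_feature w F (\<lambda>x. c * g x)"
proof -
  from assms obtain a b where "\<And>x. g x = (\<Sum>j<w. a j * F x j) + b"
    unfolding affine_feature_def by blast
  then show ?thesis
    unfolding affine_feature_def
    by (intro exI[of _ "\<lambda>j. c * a j"] exI[of _ "c * b"])
      (simp add: distrib_left sum_distrib_left mult.assoc)
qed

lemma affine_feature_sum:
  "finite S \<Longrightarrow> (\<And>k. k \<in> S \<Longrightarrow> affine_feature w F (g k)) \<Longrightarrow> affine_feature w F (\<lambda>x. \<Sum>k\<in>S. g k x)"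
  by (induction S rule: finite_induct) (simp_all add: affine_feature_const affine_feature_add)

text \<open>An affine map is Lipschitz, so it enlarges a uniform error by a constant factor at most,
  and \<open>hidden_maps_affine\<close> absorbs it into the network.\<close>

lemma approximable_affine:
  assumes F: "approximable \<sigma> w K F" and G: "\<And>i. i < w \<Longrightarrow> affine_feature w F (\<lambda>x. G x i)"
    and "w > 0"
  shows "approximable \<sigma> w K G"
  unfolding approximable_def
proof (intro allI impI)
  fix \<epsilon> :: real assume "\<epsilon> > 0"
  obtain A b where Ab: "\<And>i x. i < w \<Longrightarrow> G x i = (\<Sum>j<w. A i j * F x j) + b i"
    using G unfolding affine_feature_def by metis
  \<comment> \<open>\<open>C\<close> exceeds the absolute row sum of \<open>A\<close> for every row
    below \<open>w\<close>. The summand 1 makes \<open>C\<close> positive and the comparison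
    strict.\<close>
  define C where "C = 1 + (\<Sum>i<w. \<Sum>j<w. \<bar>A i j\<bar>)"
  have "C > 0" unfolding C_def by (simp add: add_pos_nonneg sum_nonneg)
  have C: "(\<Sum>j<w. \<bar>A i j\<bar>) < C" if "i < w" for i
    using member_le_sum[of i "{..<w}" "\<lambda>i. \<Sum>j<w. \<bar>A i j\<bar>"] that
    by (simp add: C_def sum_nonneg)
  obtain f where f: "(w, f) \<in> hidden_maps \<sigma> w"
      "\<And>x i. x \<in> K \<Longrightarrow> i < w \<Longrightarrow> \<bar>f x i - F x i\<bar> < \<epsilon> / C"
    using F \<open>\<epsilon> > 0\<close> \<open>C > 0\<close> unfolding approximable_def by (meson divide_pos_pos)
  have "\<bar>affine_layer {..<w} A b (f x) i - G x i\<bar> < \<epsilon>" if "x \<in> K" "i < w" for x i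
  proof -
    have "\<bar>affine_layer {..<w} A b (f x) i - G x i\<bar> = \<bar>\<Sum>j<w. A i j * (f x j - F x j)\<bar>"
      by (simp add: affine_layer_def Ab[OF that(2)] right_diff_distrib sum_subtractf)
    also have "\<dots> \<le> (\<Sum>j<w. \<bar>A i j\<bar> * (\<epsilon> / C))"
    proof (rule sum_abs[THEN order_trans], rule sum_mono)
      show "\<bar>A i j * (f x j - F x j)\<bar> \<le> \<bar>A i j\<bar> * (\<epsilon> / C)" if "j \<in> {..<w}" for j
        unfolding abs_mult using f(2)[OF \<open>x \<in> K\<close>, of j] that by (intro mult_left_mono) auto
    qed
    also have "\<dots> = (\<Sum>j<w. \<bar>A i j\<bar>) * (\<epsilon> / C)"
      by (rule sum_distrib_right[symmetric])
    also have "\<dots> < C * (\<epsilon> / C)"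
      using C[OF that(2)] \<open>\<epsilon> > 0\<close> \<open>C > 0\<close> by (intro mult_strict_right_mono) auto
    finally show ?thesis using \<open>C > 0\<close> by simp
  qed
  moreover have "(w, \<lambda>x. affine_layer {..<w} A b (f x)) \<in> hidden_maps \<sigma> w"
    using hidden_maps_affine[OF f(1), of w] \<open>w > 0\<close> by simp
  ultimately show "\<exists>f. (w, f) \<in> hidden_maps \<sigma> w \<and> (\<forall>x\<in>K. \<forall>i<w. \<bar>f x i - G x i\<bar> < \<epsilon>)"
    by (intro exI[of _ "\<lambda>x. affine_layer {..<w} A b (f x)"]) simp
qed

section \<open>Simulation of a scalar function by a single neuron\<close>

definition simulates :: "(real \<Rightarrow> real) \<Rightarrow> (real \<Rightarrow> real) \<Rightarrow> bool" where
  "simulates \<sigma> \<phi> \<longleftrightarrow> (\<forall>R. \<forall>\<epsilon>>0. \<exists>\<alpha> \<beta> \<gamma> \<delta>. \<forall>t. \<bar>t\<bar> \<le> R \<longrightarrow> \<bar>\<alpha> * \<sigma> (\<beta> * t + \<gamma>) + \<delta> - \<phi> t\<bar> < \<epsilon>)"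

lemma simulates_self: "simulates \<sigma> \<sigma>"
  unfolding simulates_def
proof (intro allI impI)
  fix R \<epsilon> :: real assume "\<epsilon> > 0"
  then show "\<exists>\<alpha> \<beta> \<gamma> \<delta>. \<forall>t. \<bar>t\<bar> \<le> R \<longrightarrow> \<bar>\<alpha> * \<sigma> (\<beta> * t + \<gamma>) + \<delta> - \<sigma> t\<bar> < \<epsilon>"
    by (intro exI[of _ 1] exI[of _ 0]) simp
qed

text \<open>Zooming in at \<open>x0\<close>, the quotient
  \<open>(\<sigma> (h * t + x0) - \<sigma> x0) / (h * D)\<close> tends to \<open>t\<close> uniformly
  on bounded sets as \<open>h\<close> tends to 0.\<close>

lemma simulates_id:
  assumes D: "(\<sigma> has_real_derivative D) (at x0)" and "D \<noteq> 0"
  shows "simulates \<sigma> (\<lambda>t. t)"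
  unfolding simulates_def
proof (intro allI impI)
  fix R \<epsilon> :: real assume "\<epsilon> > 0"
  \<comment> \<open>\<open>R\<close> may be zero or negative, whereas the next two constants divide
    by this bound.\<close>
  define S where "S = max R 1"
  have S: "S > 0" "R \<le> S" by (auto simp: S_def)
  \<comment> \<open>Chosen so that the final error \<open>e * S / \<bar>D\<bar>\<close> equals
    \<open>\<epsilon> / 2\<close>.\<close>
  define e where "e = \<epsilon> * \<bar>D\<bar> / (2 * S)"
  have "e > 0" using \<open>\<epsilon> > 0\<close> \<open>D \<noteq> 0\<close> S by (simp add: e_def)
  then obtain d where d: "d > 0"
      "\<And>y. \<bar>y - x0\<bar> < d \<Longrightarrow> \<bar>\<sigma> y - \<sigma> x0 - D * (y - x0)\<bar> \<le> e * \<bar>y - x0\<bar>"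
    using D unfolding has_field_derivative_def has_derivative_at_alt by (metis real_norm_def)
  \<comment> \<open>With this scale, \<open>h * t\<close> stays within distance \<open>d / 2\<close>
    of 0, where the derivative estimate applies.\<close>
  define h where "h = d / (2 * S)"
  have h: "h > 0" "h * S < d" using d(1) S by (auto simp: h_def)
  have "\<bar>1 / (h * D) * \<sigma> (h * t + x0) + (- \<sigma> x0 / (h * D)) - t\<bar> < \<epsilon>" if t: "\<bar>t\<bar> \<le> R" for t
  proof -
    have tS: "\<bar>t\<bar> \<le> S" using t S by simp
    have "h * \<bar>t\<bar> \<le> h * S" using h tS by (intro mult_left_mono) auto
    then have "h * \<bar>t\<bar> < d" using h by linarith
    then have "\<bar>(h * t + x0) - x0\<bar> < d" using h by (simp add: abs_mult)
    from d(2)[OF this] have le: "\<bar>\<sigma> (h * t + x0) - \<sigma> x0 - D * (h * t)\<bar> \<le> e * (h * \<bar>t\<bar>)"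
      using h by (simp add: abs_mult)
    have "1 / (h * D) * \<sigma> (h * t + x0) + (- \<sigma> x0 / (h * D)) - t =
        (\<sigma> (h * t + x0) - \<sigma> x0 - D * (h * t)) / (h * D)"
      using h \<open>D \<noteq> 0\<close> by (simp add: field_simps)
    also have "\<bar>\<dots>\<bar> \<le> e * (h * \<bar>t\<bar>) / (h * \<bar>D\<bar>)"
      using divide_right_mono[OF le, of "h * \<bar>D\<bar>"] h by (simp add: abs_mult)
    also have "\<dots> = e * \<bar>t\<bar> / \<bar>D\<bar>" using h by simp
    also have "\<dots> \<le> e * S / \<bar>D\<bar>"
      using tS \<open>e > 0\<close> by (intro divide_right_mono mult_left_mono) auto
    also have "\<dots> = \<epsilon> / 2" using S \<open>D \<noteq> 0\<close> by (simp add: e_def)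
    finally show ?thesis using \<open>\<epsilon> > 0\<close> by simp
  qed
  then show "\<exists>\<alpha> \<beta> \<gamma> \<delta>. \<forall>t. \<bar>t\<bar> \<le> R \<longrightarrow> \<bar>\<alpha> * \<sigma> (\<beta> * t + \<gamma>) + \<delta> - t\<bar> < \<epsilon>" by blast
qed

text \<open>Each coordinate passes through its own simulated function. The affine map after the
  activation is exposed as \<open>A\<close> and \<open>b\<close> because it has two uses: as the
  next hidden map, and, with some of its rows selected, as the output layer.\<close>

lemma approximable_activation_layer:
  assumes F: "approximable \<sigma> w K F" and "w > 0"
    and R: "\<And>x i. x \<in> K \<Longrightarrow> i < w \<Longrightarrow> \<bar>F x i\<bar> \<le> R"
    and \<sigma>: "continuous_on UNIV \<sigma>"
    and \<phi>: "\<And>i. i < w \<Longrightarrow> simulates \<sigma> (\<phi> i)"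
    and "\<epsilon> > 0"
  obtains f A b where "(w, f) \<in> hidden_maps \<sigma> w"
    and "\<And>x i. x \<in> K \<Longrightarrow> i < w \<Longrightarrow>
      \<bar>affine_layer {..<w} A b (\<lambda>j. \<sigma> (f x j)) i - \<phi> i (F x i)\<bar> < \<epsilon>"
proof -
  have "\<forall>i. \<exists>\<alpha> \<beta> \<gamma> \<delta>. i < w \<longrightarrow> (\<forall>t. \<bar>t\<bar> \<le> R \<longrightarrow> \<bar>\<alpha> * \<sigma> (\<beta> * t + \<gamma>) + \<delta> - \<phi> i t\<bar> < \<epsilon> / 2)"
    using \<phi> \<open>\<epsilon> > 0\<close> unfolding simulates_def by (meson half_gt_zero)
  then obtain \<alpha> \<beta> \<gamma> \<delta> where sim:
      "\<And>i t. i < w \<Longrightarrow> \<bar>t\<bar> \<le> R \<Longrightarrow> \<bar>\<alpha> i * \<sigma> (\<beta> i * t + \<gamma> i) + \<delta> i - \<phi> i t\<bar> < \<epsilon> / 2"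
    by metis
  define u where "u i t = \<alpha> i * \<sigma> (\<beta> i * t + \<gamma> i) + \<delta> i" for i t
  \<comment> \<open>The approximation \<open>f\<close> of \<open>F\<close> may leave the range
    bounded by \<open>R\<close>, so the interval is enlarged by 1 on both sides.\<close>
  have "uniformly_continuous_on {-R-1..R+1} (u i)" for i
    unfolding u_def
    by (intro compact_uniformly_continuous continuous_intros continuous_on_compose2[OF \<sigma>]) auto
  then have "\<exists>\<eta>>0. \<forall>s\<in>{-R-1..R+1}. \<forall>t\<in>{-R-1..R+1}. \<bar>s - t\<bar> < \<eta> \<longrightarrow> \<bar>u i s - u i t\<bar> < \<epsilon> / 2" for i
    using \<open>\<epsilon> > 0\<close> unfolding uniformly_continuous_on_def dist_real_def by (meson half_gt_zero)
  then obtain \<eta> where \<eta>: "\<And>i. \<eta> i > 0"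
      "\<And>i s t. s \<in> {-R-1..R+1} \<Longrightarrow> t \<in> {-R-1..R+1} \<Longrightarrow> \<bar>s - t\<bar> < \<eta> i \<Longrightarrow> \<bar>u i s - u i t\<bar> < \<epsilon> / 2"
    by metis
  \<comment> \<open>The entry 1 keeps \<open>f\<close> inside the enlarged interval; the others make
    the error of \<open>f\<close> harmless under each \<open>u i\<close>.\<close>
  define \<mu> where "\<mu> = Min (insert 1 (\<eta> ` {..<w}))"
  have "\<mu> > 0" "\<mu> \<le> 1" and \<mu>: "\<And>i. i < w \<Longrightarrow> \<mu> \<le> \<eta> i"
    using \<eta>(1) by (auto simp: \<mu>_def)
  then obtain f where f: "(w, f) \<in> hidden_maps \<sigma> w"
      "\<And>x i. x \<in> K \<Longrightarrow> i < w \<Longrightarrow> \<bar>f x i - F x i\<bar> < \<mu>"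
    using F unfolding approximable_def by meson
  \<comment> \<open>Diagonal weights keep the coordinates separate, so that each has its own
    scaling.\<close>
  define diag where "diag d = (\<lambda>i j. if j = i then d i else 0)" for d :: "nat \<Rightarrow> real"
  have diag: "affine_layer {..<w} (diag d) c v i = d i * v i + c i" if "i < w" for d c v i
    using that by (simp add: affine_layer_def diag_def if_distrib[of "\<lambda>u. u * _"] sum.delta cong: if_cong)
  show ?thesis
  proof
    show "(w, \<lambda>x. affine_layer {..<w} (diag \<beta>) \<gamma> (f x)) \<in> hidden_maps \<sigma> w"
      using hidden_maps_affine[OF f(1), of w] \<open>w > 0\<close> by simp
    fix x i assume xi: "x \<in> K" "i < w"
    have "affine_layer {..<w} (diag \<alpha>) \<delta> (\<lambda>j. \<sigma> (affine_layer {..<w} (diag \<beta>) \<gamma> (f x) j)) i = u i (f x i)"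
      using xi by (simp add: diag u_def)
    moreover have "\<bar>u i (f x i) - u i (F x i)\<bar> < \<epsilon> / 2"
      using f(2)[OF xi] R[OF xi] \<mu>[OF xi(2)] \<open>\<mu> \<le> 1\<close> by (intro \<eta>(2)) auto
    moreover have "\<bar>u i (F x i) - \<phi> i (F x i)\<bar> < \<epsilon> / 2"
      using sim[OF xi(2) R[OF xi]] by (simp add: u_def)
    ultimately show "\<bar>affine_layer {..<w} (diag \<alpha>) \<delta>
        (\<lambda>j. \<sigma> (affine_layer {..<w} (diag \<beta>) \<gamma> (f x) j)) i - \<phi> i (F x i)\<bar> < \<epsilon>"
      by linarith
  qed
qed

lemma approximable_activation:
  assumes "approximable \<sigma> w K F" "w > 0" "\<And>x i. x \<in> K \<Longrightarrow> i < w \<Longrightarrow> \<bar>F x i\<bar> \<le> R"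
    and "continuous_on UNIV \<sigma>" "\<And>i. i < w \<Longrightarrow> simulates \<sigma> (\<phi> i)"
  shows "approximable \<sigma> w K (\<lambda>x i. \<phi> i (F x i))"
  unfolding approximable_def
proof (intro allI impI)
  fix \<epsilon> :: real assume "\<epsilon> > 0"
  obtain f A b where f: "(w, f) \<in> hidden_maps \<sigma> w"
    and "\<And>x i. x \<in> K \<Longrightarrow> i < w \<Longrightarrow>
      \<bar>affine_layer {..<w} A b (\<lambda>j. \<sigma> (f x j)) i - \<phi> i (F x i)\<bar> < \<epsilon>"
    using approximable_activation_layer[where \<phi> = \<phi>, OF assms \<open>\<epsilon> > 0\<close>] by blast
  moreover have "(w, \<lambda>x. affine_layer {..<w} A b (\<lambda>j. \<sigma> (f x j))) \<in> hidden_maps \<sigma> w"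
    using hidden_maps.step[OF f, of w] \<open>w > 0\<close> by simp
  ultimately show "\<exists>f. (w, f) \<in> hidden_maps \<sigma> w \<and> (\<forall>x\<in>K. \<forall>i<w. \<bar>f x i - \<phi> i (F x i)\<bar> < \<epsilon>)"
    by (intro exI[of _ "\<lambda>x. affine_layer {..<w} A b (\<lambda>j. \<sigma> (f x j))"]) simp
qed


section \<open>Shift-invariant spaces of polynomials\<close>

text \<open>In the binomial expansion of \<open>r (x + 1)\<close> only the powers \<open>d\<close>
  and \<open>Suc d\<close> contribute to this coefficient, with binomials 1 and
  \<open>Suc d\<close>. The degree is only bounded above, so the formula also covers coefficients at
  and beyond the degree of \<open>r\<close>.\<close>

lemma coeff_pcompose_shift:
  fixes r :: "'a::comm_ring_1 poly"
  assumes "degree r \<le> Suc d"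
  shows "coeff (r \<circ>\<^sub>p [:1, 1:]) d = coeff r d + of_nat (Suc d) * coeff r (Suc d)"
proof -
  have power: "(s ^ i) \<circ>\<^sub>p q = (s \<circ>\<^sub>p q) ^ i" for s q :: "'a poly" and i
    by (induction i) (simp_all add: pcompose_1 pcompose_mult)
  have choose: "coeff ([:1, 1:] ^ i) d = (of_nat (i choose d) :: 'a)" for i
  proof (cases "d \<le> i")
    case False
    then have "degree ([:1, 1 :: 'a:] ^ i) < d"
      using degree_power_le[of "[:1, 1 :: 'a:]" i] by simp
    with False show ?thesis by (simp add: coeff_eq_0 binomial_eq_0)
  qed (simp add: coeff_linear_poly_power)
  have "r \<circ>\<^sub>p [:1, 1:] = (\<Sum>i\<le>Suc d. smult (coeff r i) ([:1, 1:] ^ i))"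
    using arg_cong[OF poly_as_sum_of_monoms'[OF assms], of "\<lambda>s. s \<circ>\<^sub>p [:1, 1:]"]
    by (simp only: pcompose_sum monom_altdef pcompose_smult power) (simp add: pcompose_pCons)
  then have "coeff (r \<circ>\<^sub>p [:1, 1:]) d = (\<Sum>i\<le>Suc d. coeff r i * of_nat (i choose d))"
    by (simp only: coeff_sum coeff_smult choose)
  also have "\<dots> = coeff r d + of_nat (Suc d) * coeff r (Suc d)"
    by (simp add: lessThan_Suc_atMost[symmetric] binomial_eq_0 mult.commute)
  finally show ?thesis .
qed

text \<open>The difference \<open>r (x + 1) - r x\<close> has degree exactly one less than a
  nonconstant \<open>r\<close>. By induction \<open>V\<close> contains all polynomials of smaller
  degree, and subtracting a multiple of \<open>r\<close> reduces \<open>u\<close> to one of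
  these.\<close>

lemma shift_invariant_polys:
  fixes V :: "real poly set"
  assumes add: "\<And>r s. r \<in> V \<Longrightarrow> s \<in> V \<Longrightarrow> r + s \<in> V"
    and smult: "\<And>c r. r \<in> V \<Longrightarrow> smult c r \<in> V"
    and shift: "\<And>r. r \<in> V \<Longrightarrow> r \<circ>\<^sub>p [:1, 1:] \<in> V"
    and "r \<in> V" "r \<noteq> 0" "degree u \<le> degree r"
  shows "u \<in> V"
  using \<open>r \<in> V\<close> \<open>r \<noteq> 0\<close> \<open>degree u \<le> degree r\<close>
proof (induction "degree r" arbitrary: r u)
  case 0
  then obtain a c where "r = [:a:]" "u = [:c:]"
    by (metis degree_0_id le_zero_eq)
  then have "u = smult (c / a) r" using 0 by simp
  then show ?case using smult[OF \<open>r \<in> V\<close>] by simp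
next
  case (Suc d)
  define s where "s = r \<circ>\<^sub>p [:1, 1:] + smult (-1) r"
  have "s \<in> V" unfolding s_def by (intro add shift smult Suc.prems)
  have lc: "coeff r (Suc d) \<noteq> 0" using Suc by (metis leading_coeff_0_iff)
  have coeff_s: "coeff s d \<noteq> 0"
    using lc coeff_pcompose_shift[of r d] Suc.hyps(2) by (simp add: s_def)
  \<comment> \<open>For these indices the shift formula reduces to \<open>coeff r i\<close>, which
    cancels against the subtracted \<open>r\<close>.\<close>
  have high: "coeff s i = 0" if "i \<ge> Suc d" for i
  proof -
    have "degree r \<le> Suc i" "coeff r (Suc i) = 0"
      using that Suc.hyps(2) by (auto intro: coeff_eq_0)
    then show ?thesis using coeff_pcompose_shift[of r i] by (simp add: s_def)
  qed
  have deg_s: "d = degree s"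
    using le_degree[OF coeff_s] degree_le[of d s] high by (simp add: Suc_le_eq)
  \<comment> \<open>Cancels the coefficient of \<open>u\<close> at \<open>Suc d\<close>; it is 0 if
    \<open>u\<close> already has smaller degree.\<close>
  define c where "c = coeff u (Suc d) / coeff r (Suc d)"
  have "degree (u - smult c r) \<le> d"
  proof (rule degree_le, intro allI impI)
    fix i assume "d < i"
    show "coeff (u - smult c r) i = 0"
    proof (cases "i = Suc d")
      case True
      then show ?thesis using lc by (simp add: c_def)
    next
      case False
      then have "degree r < i" "degree u < i" using \<open>d < i\<close> Suc by auto
      then show ?thesis by (simp add: coeff_eq_0)
    qed
  qed
  then have "u - smult c r \<in> V"
    using Suc.hyps(1)[OF deg_s \<open>s \<in> V\<close>] coeff_s deg_s by auto
  then have "(u - smult c r) + smult c r \<in> V"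
    by (intro add smult Suc.prems)
  then show ?case by simp
qed


section \<open>Registers\<close>

text \<open>\<open>e\<close> and \<open>e'\<close> number the coordinates of input and output, since
  hidden vectors are indexed by natural numbers.\<close>

locale register_net =
  fixes p :: "real poly" and K :: "(real ^ 'n) set" and e :: "nat \<Rightarrow> 'n" and e' :: "nat \<Rightarrow> 'm::finite"
    and w :: nat
  assumes compact_K: "compact K"
    and degree_p: "degree p \<ge> 2"
    and e: "bij_betw e {..<CARD('n)} UNIV" and e': "bij_betw e' {..<CARD('m)} UNIV"
    and w_eq: "w = CARD('n) + CARD('m) + 1"
begin

lemma w_pos: "w > 0"
  by (simp add: w_eq)

text \<open>Among the indices below \<open>w\<close>, only the last one, \<open>w - 1\<close>, is
  the scratch register.\<close>

definition registers ::
  "(real ^ 'n \<Rightarrow> real ^ 'm) \<Rightarrow> (real ^ 'n \<Rightarrow> real) \<Rightarrow> real ^ 'n \<Rightarrow> nat \<Rightarrow> real" where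
  "registers y z x i =
     (if i < CARD('n) then x $ e i else if i < CARD('n) + CARD('m) then y x $ e' (i - CARD('n)) else z x)"

lemma registers_input:
  obtains i where "i < CARD('n)" "\<And>y z x. registers y z x i = x $ k"
proof -
  obtain i where "i < CARD('n)" "e i = k"
    using e unfolding bij_betw_def by (metis UNIV_I imageE lessThan_iff)
  with that show thesis by (simp add: registers_def)
qed

lemma registers_accumulator:
  obtains i where "i < w" "\<And>y z x. registers y z x i = y x $ k"
proof -
  obtain i where "i < CARD('m)" "e' i = k"
    using e' unfolding bij_betw_def by (metis UNIV_I imageE lessThan_iff)
  with that[of "CARD('n) + i"] show thesis by (simp add: registers_def w_eq)
qed

lemma affine_feature_input: "affine_feature w (registers y z) (\<lambda>x. x $ k)"
proof -
  obtain i where i: "i < CARD('n)" "\<And>y z x. registers y z x i = x $ k"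
    using registers_input[of k] by blast
  then have "affine_feature w (registers y z) (\<lambda>x. registers y z x i)"
    by (intro affine_feature_coordinate) (simp add: w_eq)
  then show ?thesis by (simp add: i(2))
qed

lemma affine_feature_accumulator: "affine_feature w (registers y z) (\<lambda>x. y x $ k)"
proof -
  obtain i where i: "i < w" "\<And>y z x. registers y z x i = y x $ k"
    using registers_accumulator[of k] by blast
  from affine_feature_coordinate[OF i(1), of "registers y z"] show ?thesis by (simp add: i(2))
qed

lemma affine_feature_scratch: "affine_feature w (registers y z) z"
  using affine_feature_coordinate[of "w - 1" w "registers y z"] by (simp add: registers_def w_eq)

text \<open>The input registers carry over because every input coordinate is itself an affine
  feature; only the new accumulator and scratch value have to be checked.\<close>

lemma approximable_registers_affine:
  assumes "approximable \<sigma> w K (registers y z)"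
    and "\<And>k. affine_feature w (registers y z) (\<lambda>x. y' x $ k)"
    and "affine_feature w (registers y z) z'"
  shows "approximable \<sigma> w K (registers y' z')"
proof (rule approximable_affine[OF assms(1)])
  fix i assume "i < w"
  consider "i < CARD('n)" | "CARD('n) \<le> i" "i < CARD('n) + CARD('m)" | "CARD('n) + CARD('m) \<le> i"
    by linarith
  then show "affine_feature w (registers y z) (\<lambda>x. registers y' z' x i)"
  proof cases
    case 1
    then show ?thesis using affine_feature_input[of y z "e i"] by (simp add: registers_def)
  next
    case 2
    then show ?thesis using assms(2)[of "e' (i - CARD('n))"] by (simp add: registers_def)
  next
    case 3
    then show ?thesis using assms(3) by (simp add: registers_def)
  qed
qed (rule w_pos)

lemma norm_bound_on_K:
  fixes f :: "real ^ 'n \<Rightarrow> 'c::real_normed_vector"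
  assumes "continuous_on K f"
  shows "\<exists>B. \<forall>x\<in>K. norm (f x) \<le> B"
  using compact_imp_bounded[OF compact_continuous_image[OF assms compact_K]]
  by (simp add: bounded_iff)

lemma registers_bounded:
  assumes "continuous_on K y" "continuous_on K z"
  obtains R where "\<And>x i. x \<in> K \<Longrightarrow> i < w \<Longrightarrow> \<bar>registers y z x i\<bar> \<le> R"
proof -
  obtain A B C where A: "\<And>x. x \<in> K \<Longrightarrow> norm x \<le> A" and B: "\<And>x. x \<in> K \<Longrightarrow> norm (y x) \<le> B"
      and C: "\<And>x. x \<in> K \<Longrightarrow> norm (z x) \<le> C"
    using norm_bound_on_K[OF continuous_on_id] norm_bound_on_K[OF assms(1)]
      norm_bound_on_K[OF assms(2)] by metis
  have "\<bar>registers y z x i\<bar> \<le> max A (max B C)" if "x \<in> K" for x i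
  proof -
    have "\<bar>x $ k\<bar> \<le> A" "\<bar>y x $ j\<bar> \<le> B" "\<bar>z x\<bar> \<le> C" for k j
      using A[OF that] B[OF that] C[OF that] component_le_norm_cart[of x k]
        component_le_norm_cart[of "y x" j] by auto
    then show ?thesis by (auto simp: registers_def le_max_iff_disj)
  qed
  with that show thesis by blast
qed

text \<open>The derivative of \<open>p\<close> is a nonzero polynomial, so it is nonzero at some
  real point.\<close>

lemma simulates_id_p: "simulates (poly p) (\<lambda>t. t)"
proof -
  have "pderiv p \<noteq> 0" using degree_p by (simp add: pderiv_eq_0_iff)
  then obtain x0 where "poly (pderiv p) x0 \<noteq> 0"
    using poly_all_0_iff_0 by blast
  then show ?thesis using simulates_id[OF poly_DERIV] by blast
qed

lemma approximable_registers_p: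
  assumes "approximable (poly p) w K (registers y z)"
    and "continuous_on K y" "continuous_on K z"
  shows "approximable (poly p) w K (registers y (\<lambda>x. poly p (z x)))"
proof -
  obtain R where R: "\<And>x i. x \<in> K \<Longrightarrow> i < w \<Longrightarrow> \<bar>registers y z x i\<bar> \<le> R"
    using registers_bounded[OF assms(2,3)] by blast
  define \<phi> where "\<phi> i = (if i < CARD('n) + CARD('m) then \<lambda>t. t else poly p)" for i
  have "approximable (poly p) w K (\<lambda>x i. \<phi> i (registers y z x i))"
  proof (rule approximable_activation[OF assms(1) w_pos R continuous_on_poly[OF continuous_on_id]])
    show "simulates (poly p) (\<phi> i)" for i
      using simulates_id_p simulates_self by (simp add: \<phi>_def)
  qed
  moreover have "(\<lambda>x i. \<phi> i (registers y z x i)) = registers y (\<lambda>x. poly p (z x))"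
    by (auto simp: \<phi>_def registers_def fun_eq_iff)
  ultimately show ?thesis by simp
qed

text \<open>The accumulator \<open>y\<close> is arbitrary and the scratch register is 0 before and
  after, so additions can be chained. The factor \<open>c\<close> gives closure under scalar
  multiples, and approximability instead of exact representation gives closure under uniform
  limits.\<close>

definition addable :: "(real ^ 'n \<Rightarrow> real) \<Rightarrow> bool" where
  "addable h \<longleftrightarrow> continuous_on K h \<and>
     (\<forall>y k c. continuous_on K y \<longrightarrow> approximable (poly p) w K (registers y (\<lambda>_. 0)) \<longrightarrow>
        approximable (poly p) w K (registers (\<lambda>x. y x + axis k (c * h x)) (\<lambda>_. 0)))"

lemma continuous_on_axis: "continuous_on S h \<Longrightarrow> continuous_on S (\<lambda>x. axis k (h x :: real))"
  unfolding axis_def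
proof (rule continuous_on_vec_lambda)
  show "continuous_on S h \<Longrightarrow> continuous_on S (\<lambda>x. if i = k then h x else 0)" for i
    by (cases "i = k") simp_all
qed

lemma addable_add:
  assumes "addable g" "addable h"
  shows "addable (\<lambda>x. g x + h x)"
  unfolding addable_def
proof (intro conjI allI impI)
  show "continuous_on K (\<lambda>x. g x + h x)"
    using assms by (auto simp: addable_def intro!: continuous_intros)
  fix y :: "real ^ 'n \<Rightarrow> real ^ 'm" and k c
  assume y: "continuous_on K y" "approximable (poly p) w K (registers y (\<lambda>_. 0))"
  have "continuous_on K (\<lambda>x. y x + axis k (c * g x))"
    using assms(1) y by (auto simp: addable_def intro!: continuous_intros continuous_on_axis)
  then have "approximable (poly p) w K (registers (\<lambda>x. y x + axis k (c * g x) + axis k (c * h x)) (\<lambda>_. 0))"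
    using assms y unfolding addable_def by blast
  moreover have "y x + axis k (c * g x) + axis k (c * h x) = y x + axis k (c * (g x + h x))" for x
    by (simp add: vec_eq_iff axis_def distrib_left)
  ultimately show "approximable (poly p) w K (registers (\<lambda>x. y x + axis k (c * (g x + h x))) (\<lambda>_. 0))"
    by simp
qed

lemma addable_cmult:
  assumes "addable h"
  shows "addable (\<lambda>x. d * h x)"
  using assms unfolding addable_def mult.assoc[symmetric]
  by (auto intro!: continuous_intros)

lemma addable_limit:
  assumes h: "continuous_on K h"
    and lim: "\<And>\<epsilon>. \<epsilon> > 0 \<Longrightarrow> \<exists>g. addable g \<and> (\<forall>x\<in>K. \<bar>h x - g x\<bar> < \<epsilon>)"
  shows "addable h"
  unfolding addable_def
proof (intro conjI allI impI h)
  fix y :: "real ^ 'n \<Rightarrow> real ^ 'm" and k c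
  assume y: "continuous_on K y" "approximable (poly p) w K (registers y (\<lambda>_. 0))"
  show "approximable (poly p) w K (registers (\<lambda>x. y x + axis k (c * h x)) (\<lambda>_. 0))"
  proof (rule approximable_limit)
    fix \<epsilon> :: real assume "\<epsilon> > 0"
    \<comment> \<open>Adding \<open>c * g\<close> multiplies the error by
      \<open>\<bar>c\<bar>\<close>; the summand 1 also covers \<open>c = 0\<close>.\<close>
    then obtain g where g: "addable g" "\<And>x. x \<in> K \<Longrightarrow> \<bar>h x - g x\<bar> < \<epsilon> / (\<bar>c\<bar> + 1)"
      using lim[of "\<epsilon> / (\<bar>c\<bar> + 1)"] by auto
    have "\<bar>c * g x - c * h x\<bar> < \<epsilon>" if "x \<in> K" for x
    proof -
      have "\<bar>c * g x - c * h x\<bar> = \<bar>c\<bar> * \<bar>h x - g x\<bar>"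
        by (metis abs_minus_commute abs_mult right_diff_distrib)
      also have "\<dots> \<le> \<bar>c\<bar> * (\<epsilon> / (\<bar>c\<bar> + 1))"
        using g(2)[OF that] by (intro mult_left_mono) auto
      also have "\<dots> < \<epsilon>" using \<open>\<epsilon> > 0\<close> by (simp add: field_simps add_strict_increasing)
      finally show ?thesis .
    qed
    then have "\<bar>registers (\<lambda>x. y x + axis k (c * g x)) (\<lambda>_. 0) x i
        - registers (\<lambda>x. y x + axis k (c * h x)) (\<lambda>_. 0) x i\<bar> < \<epsilon>" if "x \<in> K" for x i
      using that \<open>\<epsilon> > 0\<close> by (simp add: registers_def axis_def)
    with g(1) y show "\<exists>G. approximable (poly p) w K G \<and>
        (\<forall>x\<in>K. \<forall>i<w. \<bar>G x i - registers (\<lambda>x. y x + axis k (c * h x)) (\<lambda>_. 0) x i\<bar> < \<epsilon>)"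
      unfolding addable_def by blast
  qed
qed

text \<open>The iteration starts at the identity polynomial \<open>[:0, 1:]\<close>, and each
  composition multiplies the degree by at least 2. The crude bound \<open>n\<close> suffices to
  reach every degree.\<close>

lemma degree_funpow_pcompose: "n \<le> degree (((\<lambda>q. p \<circ>\<^sub>p q) ^^ n) [:0, 1:])"
proof (induction n)
  case (Suc n)
  let ?d = "degree (((\<lambda>q. p \<circ>\<^sub>p q) ^^ n) [:0, 1:])"
  show ?case
  proof (cases n)
    case 0
    then show ?thesis using degree_p by simp
  next
    case (Suc k)
    have "2 * ?d \<le> degree p * ?d" using degree_p by (rule mult_right_mono) simp
    also have "\<dots> = degree (((\<lambda>q. p \<circ>\<^sub>p q) ^^ Suc n) [:0, 1:])" by (simp add: degree_pcompose)
    finally show ?thesis using Suc.IH Suc by linarith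
  qed
qed simp

text \<open>An affine map loads \<open>a \<bullet> x + b\<close> into the scratch register,
  \<open>n\<close> layers apply \<open>p\<close> to it, and a last affine map adds the multiple to
  coordinate \<open>k\<close>.\<close>

lemma addable_iterate:
  "addable (\<lambda>x. poly (((\<lambda>q. p \<circ>\<^sub>p q) ^^ n) [:0, 1:]) (a \<bullet> x + b))"
proof -
  let ?q = "\<lambda>n. ((\<lambda>q. p \<circ>\<^sub>p q) ^^ n) [:0, 1:]"
  have cont: "continuous_on K (\<lambda>x. poly (?q n) (a \<bullet> x + b))" for n
    by (intro continuous_intros)
  show ?thesis
    unfolding addable_def
  proof (intro conjI allI impI cont)
    fix y :: "real ^ 'n \<Rightarrow> real ^ 'm" and k c
    assume y: "continuous_on K y" "approximable (poly p) w K (registers y (\<lambda>_. 0))"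
    have "approximable (poly p) w K (registers y (\<lambda>x. poly (?q n) (a \<bullet> x + b)))"
    proof (induction n)
      case 0
      show ?case
        by (rule approximable_registers_affine[OF y(2)])
          (auto simp: inner_vec_def intro!: affine_feature_accumulator affine_feature_add
            affine_feature_sum affine_feature_cmult affine_feature_input affine_feature_const)
    next
      case (Suc n)
      from approximable_registers_p[OF Suc y(1) cont] show ?case by (simp add: poly_pcompose)
    qed
    then show "approximable (poly p) w K
        (registers (\<lambda>x. y x + axis k (c * poly (?q n) (a \<bullet> x + b))) (\<lambda>_. 0))"
    proof (rule approximable_registers_affine)
      fix j
      let ?F = "registers y (\<lambda>x. poly (?q n) (a \<bullet> x + b))"
      have "affine_feature w ?F (\<lambda>x. y x $ j + (if j = k then c else 0) * poly (?q n) (a \<bullet> x + b))"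
        by (intro affine_feature_add affine_feature_accumulator affine_feature_cmult affine_feature_scratch)
      moreover have "(y x + axis k (c * s)) $ j = y x $ j + (if j = k then c else 0) * s" for x s
        by (simp add: axis_def)
      ultimately show "affine_feature w ?F (\<lambda>x. (y x + axis k (c * poly (?q n) (a \<bullet> x + b))) $ j)"
        by simp
    \<comment> \<open>The same affine map resets the scratch register to 0.\<close>
    qed (rule affine_feature_const)
  qed
qed

lemma addable_poly: "addable (\<lambda>x. poly u (a \<bullet> x + b))"
proof -
  \<comment> \<open>Quantifying over all offsets \<open>b\<close> makes \<open>V\<close>
    shift-invariant: a shift by 1 only changes the offset.\<close>
  define V where "V = {r. \<forall>a b. addable (\<lambda>x. poly r (a \<bullet> x + b))}"
  \<comment> \<open>The successor makes the degree positive, hence \<open>?r\<close> nonzero, even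
    for constant \<open>u\<close>.\<close>
  let ?r = "((\<lambda>q. p \<circ>\<^sub>p q) ^^ Suc (degree u)) [:0, 1:]"
  have deg: "Suc (degree u) \<le> degree ?r" by (rule degree_funpow_pcompose)
  have "u \<in> V"
  proof (rule shift_invariant_polys)
    show "?r \<in> V" using addable_iterate[of "Suc (degree u)"] by (simp add: V_def)
    show "?r \<noteq> 0" using deg by (metis degree_0 not_less_eq_eq le0)
    show "degree u \<le> degree ?r" using deg by simp
    show "r \<circ>\<^sub>p [:1, 1:] \<in> V" if "r \<in> V" for r
    proof -
      have "addable (\<lambda>x. poly r (a \<bullet> x + (b + 1)))" for a b
        using that by (simp add: V_def)
      then show ?thesis by (simp add: V_def poly_pcompose add_ac)
    qed
  qed (auto simp: V_def addable_add addable_cmult)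
  then show ?thesis by (simp add: V_def)
qed

section \<open>From polynomials in one direction to all continuous functions\<close>

lemma addable_ridge:
  assumes g: "continuous_on UNIV g"
  shows "addable (\<lambda>x. g (a \<bullet> x))"
proof (rule addable_limit)
  show "continuous_on K (\<lambda>x. g (a \<bullet> x))"
    by (intro continuous_on_compose2[OF g] continuous_intros) auto
  fix \<epsilon> :: real assume "\<epsilon> > 0"
  \<comment> \<open>The image of \<open>K\<close> on the line is compact, so the one-variable
    Weierstrass theorem replaces \<open>g\<close> by a polynomial.\<close>
  have "compact ((\<lambda>x. a \<bullet> x) ` K)"
    by (intro compact_continuous_image compact_K continuous_intros)
  then obtain h where h: "real_polynomial_function h"
      "\<And>t. t \<in> (\<lambda>x. a \<bullet> x) ` K \<Longrightarrow> \<bar>g t - h t\<bar> < \<epsilon>"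
    using Stone_Weierstrass_real_polynomial_function[OF _ continuous_on_subset[OF g subset_UNIV] \<open>\<epsilon> > 0\<close>]
    by blast
  then obtain c n where "h = (\<lambda>t. \<Sum>i\<le>n. c i * t ^ i)"
    using real_polynomial_function_iff_sum by blast
  then have "h t = poly (\<Sum>i\<le>n. monom (c i) i) t" for t
    by (simp add: poly_sum poly_monom)
  then have "addable (\<lambda>x. h (a \<bullet> x))"
    using addable_poly[of _ a 0] by simp
  with h(2) show "\<exists>g'. addable g' \<and> (\<forall>x\<in>K. \<bar>g (a \<bullet> x) - g' x\<bar> < \<epsilon>)" by blast
qed

text \<open>The linear span of the exponentials, with scalars built into the first clause. Unlike
  addability, its closure under products is immediate, because exponents add.\<close>

inductive_set exp_sums :: "(real ^ 'n \<Rightarrow> real) set" where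
  exp: "(\<lambda>x. c * exp (a \<bullet> x)) \<in> exp_sums"
| add: "f \<in> exp_sums \<Longrightarrow> g \<in> exp_sums \<Longrightarrow> (\<lambda>x. f x + g x) \<in> exp_sums"

lemma exp_sums_mult:
  assumes "f \<in> exp_sums" "g \<in> exp_sums"
  shows "(\<lambda>x. f x * g x) \<in> exp_sums"
  using assms(1)
proof induction
  case (exp c a)
  show ?case
    using assms(2)
  proof induction
    case (exp d b)
    have "(\<lambda>x. c * exp (a \<bullet> x) * (d * exp (b \<bullet> x))) = (\<lambda>x. (c * d) * exp ((a + b) \<bullet> x))"
      by (simp add: inner_add_left exp_add mult_ac)
    then show ?case using exp_sums.exp[of "c * d" "a + b"] by simp
  next
    case (add f g)
    then show ?case by (simp add: distrib_left exp_sums.add)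
  qed
next
  case (add f g)
  then show ?case by (simp add: distrib_right exp_sums.add)
qed

text \<open>Every exponential sum is addable, Stone-Weierstrass makes these sums uniformly dense on
  \<open>K\<close>, and addability survives uniform limits.\<close>

lemma addable_continuous:
  assumes "continuous_on K h"
  shows "addable h"
proof (rule addable_limit[OF assms])
  fix \<epsilon> :: real assume "\<epsilon> > 0"
  have addable: "addable f" if "f \<in> exp_sums" for f
    using that by induction (auto intro!: addable_add addable_cmult addable_ridge continuous_intros)
  interpret function_ring_on exp_sums K
  proof
    show "continuous_on K f" if "f \<in> exp_sums" for f
      using addable[OF that] by (simp add: addable_def)
    show "(\<lambda>_. c) \<in> exp_sums" for c
      using exp_sums.exp[of c 0] by simp
    show "\<exists>f\<in>exp_sums. f x \<noteq> f y" if "x \<noteq> y" for x y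
    proof -
      \<comment> \<open>The two inner products differ by \<open>(x - y) \<bullet> (x - y)\<close>,
        and \<open>exp\<close> is injective, so the exponential in direction \<open>x - y\<close>
        separates the points.\<close>
      have "(x - y) \<bullet> x \<noteq> (x - y) \<bullet> y"
        using that by (metis inner_diff_right inner_eq_zero_iff right_minus_eq)
      then show ?thesis
        using exp_sums.exp[of 1 "x - y"] by (intro bexI) auto
    qed
  qed (auto intro: compact_K exp_sums.add exp_sums_mult)
  show "\<exists>g. addable g \<and> (\<forall>x\<in>K. \<bar>h x - g x\<bar> < \<epsilon>)"
    using Stone_Weierstrass_basic[OF assms \<open>\<epsilon> > 0\<close>] addable by blast
qed

text \<open>Starting from a zero accumulator, the coordinates of \<open>f\<close> are added one
  after another.\<close>

lemma approximable_registers_continuous: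
  assumes f: "continuous_on K f"
  shows "approximable (poly p) w K (registers f (\<lambda>_. 0))"
proof -
  define y where "y J x = (\<chi> j. if j \<in> J then f x $ j else 0)" for J x
  have cont: "continuous_on K (y J)" for J
    unfolding y_def
  proof (rule continuous_on_vec_lambda)
    show "continuous_on K (\<lambda>x. if j \<in> J then f x $ j else 0)" for j
      by (cases "j \<in> J") (auto intro!: continuous_intros f)
  qed
  have "approximable (poly p) w K (registers (y J) (\<lambda>_. 0))" if "finite J" for J
    using that
  proof induction
    case empty
    \<comment> \<open>The initial state is exact: one affine layer copies the input and sets all
      other registers to 0.\<close>
    have "(w, \<lambda>x. affine_layer UNIV (\<lambda>i j. if i < CARD('n) \<and> j = e i then 1 else 0) (\<lambda>_. 0) (($) x))
        \<in> hidden_maps (poly p) w"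
      by (rule hidden_maps.first) (simp add: w_eq)
    moreover have "(\<lambda>x. affine_layer UNIV (\<lambda>i j. if i < CARD('n) \<and> j = e i then 1 else 0) (\<lambda>_. 0) (($) x))
        = registers (y {}) (\<lambda>_. 0)"
      by (auto simp: affine_layer_def registers_def y_def fun_eq_iff if_distrib[of "\<lambda>u. u * _"]
          cong: if_cong)
    ultimately have "(w, registers (y {}) (\<lambda>_. 0)) \<in> hidden_maps (poly p) w" by simp
    then show ?case unfolding approximable_def by (metis abs_zero diff_self)
  next
    case (insert k J)
    have "addable (\<lambda>x. f x $ k)"
      by (intro addable_continuous continuous_intros f)
    then have "approximable (poly p) w K (registers (\<lambda>x. y J x + axis k (1 * f x $ k)) (\<lambda>_. 0))"
      using insert.IH cont unfolding addable_def by blast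
    moreover have "(\<lambda>x. y J x + axis k (1 * f x $ k)) = y (insert k J)"
      using insert.hyps by (auto simp: y_def fun_eq_iff vec_eq_iff axis_def)
    ultimately show ?case by simp
  qed
  moreover have "y UNIV = f" by (simp add: y_def fun_eq_iff vec_lambda_eta)
  ultimately show ?thesis using finite[of UNIV] by metis
qed

text \<open>A network must still pass through an activation before its output layer. A final layer
  simulating the identity in every register supplies it, after which the accumulator is read
  off.\<close>

lemma deep_narrow_mlps_dense:
  fixes f :: "real ^ 'n \<Rightarrow> real ^ 'm"
  assumes f: "continuous_on K f" and "\<epsilon> > 0"
  obtains g where "g \<in> deep_narrow_mlps (poly p) w" "\<And>x k. x \<in> K \<Longrightarrow> \<bar>g x $ k - f x $ k\<bar> < \<epsilon>"
proof -
  have F: "approximable (poly p) w K (registers f (\<lambda>_. 0))"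
    by (rule approximable_registers_continuous[OF f])
  obtain R where R: "\<And>x i. x \<in> K \<Longrightarrow> i < w \<Longrightarrow> \<bar>registers f (\<lambda>_. 0) x i\<bar> \<le> R"
    using registers_bounded[OF f continuous_on_const] by blast
  obtain h A b where h: "(w, h) \<in> hidden_maps (poly p) w"
    and approx: "\<And>x i. x \<in> K \<Longrightarrow> i < w \<Longrightarrow>
      \<bar>affine_layer {..<w} A b (\<lambda>j. poly p (h x j)) i - registers f (\<lambda>_. 0) x i\<bar> < \<epsilon>"
    using approximable_activation_layer[where \<phi> = "\<lambda>_ t. t", OF F w_pos R
        continuous_on_poly[OF continuous_on_id] simulates_id_p \<open>\<epsilon> > 0\<close>] by blast
  have "\<forall>k. \<exists>i<w. \<forall>x. registers f (\<lambda>_. 0) x i = f x $ k"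
    using registers_accumulator by metis
  then obtain idx where idx: "\<And>k. idx k < w" "\<And>k x. registers f (\<lambda>_. 0) x (idx k) = f x $ k"
    by metis
  \<comment> \<open>The output layer keeps just those rows of \<open>A\<close> and \<open>b\<close>
    that belong to the accumulator, one for each output coordinate.\<close>
  let ?g = "\<lambda>x. vec_lambda (affine_layer {..<w} (\<lambda>k. A (idx k)) (\<lambda>k. b (idx k)) (\<lambda>j. poly p (h x j)))"
  show thesis
  proof
    show "?g \<in> deep_narrow_mlps (poly p) w"
      unfolding deep_narrow_mlps_def using h by blast
    show "\<bar>?g x $ k - f x $ k\<bar> < \<epsilon>" if "x \<in> K" for x k
      using approx[OF that idx(1)[of k]] by (simp add: idx(2) affine_layer_def)
  qed
qed

end

section \<open>Continuity of networks and closure in the uniform metric\<close>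

lemma continuous_on_deep_narrow_mlps:
  assumes "continuous_on UNIV \<sigma>" "f \<in> deep_narrow_mlps \<sigma> w"
  shows "continuous_on S f"
proof -
  have activation: "continuous_on S (\<lambda>x. \<sigma> (h x))" if "continuous_on S h" for h
    using continuous_on_compose2[OF assms(1) that] by simp
  have hidden: "continuous_on S (\<lambda>x. g x i)" if "(l, g) \<in> hidden_maps \<sigma> w" for l g i
    using that
    by (induction arbitrary: i)
      (auto simp: affine_layer_def intro!: continuous_intros activation)
  from assms(2) show ?thesis
    unfolding deep_narrow_mlps_def
    by (auto simp: affine_layer_def intro!: continuous_intros continuous_on_vec_lambda
        activation dest: hidden intro: matrix_vector_mult_linear_continuous_on)
qed

lemma infnorm_le_cart: "(\<And>k. \<bar>x $ k\<bar> \<le> r) \<Longrightarrow> infnorm (x :: real ^ 'm) \<le> r"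
  unfolding infnorm_def by (intro cSup_least) (auto simp: Basis_vec_def inner_axis)

theorem corollary18:
  fixes K :: "(real ^ 'n) set" and p :: "real poly"
  assumes "compact K"
    and "\<not> (\<exists>a b. \<forall>x. poly p x = a * x + b)"
  shows "mtopology_of (unif_metric K) closure_of
           ((\<lambda>f. restrict f K) ` deep_narrow_mlps (poly p) (CARD('n) + CARD('m) + 1))
         = (C_on K :: (real ^ 'n \<Rightarrow> real ^ 'm) set)"
proof -
  let ?M = "unif_metric K :: (real ^ 'n \<Rightarrow> real ^ 'm) metric"
  let ?N = "deep_narrow_mlps (poly p) (CARD('n) + CARD('m) + 1) :: (real ^ 'n \<Rightarrow> real ^ 'm) set"
  have space: "mspace ?M = C_on K" by (rule mspace_unif_metric[OF assms(1)])
  have "degree p \<ge> 2"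
  proof (rule ccontr)
    assume "\<not> degree p \<ge> 2"
    then have "degree p \<le> 1" by simp
    then have "poly p x = coeff p 1 * x + coeff p 0" for x
      by (subst poly_altdef) (use le_Suc_eq[of "degree p" 0] in \<open>auto simp: coeff_eq_0\<close>)
    with assms(2) show False by blast
  qed
  moreover obtain e :: "nat \<Rightarrow> 'n" where "bij_betw e {..<CARD('n)} UNIV"
    using ex_bij_betw_nat_finite[of "UNIV :: 'n set"] by (auto simp: atLeast0LessThan)
  moreover obtain e' :: "nat \<Rightarrow> 'm" where "bij_betw e' {..<CARD('m)} UNIV"
    using ex_bij_betw_nat_finite[of "UNIV :: 'm set"] by (auto simp: atLeast0LessThan)
  ultimately interpret register_net p K e e' "CARD('n) + CARD('m) + 1"
    using assms(1) by unfold_locales simp_all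
  \<comment> \<open>Restricted networks must be points of the metric space before they can lie in a
    ball around \<open>f\<close>.\<close>
  have restrict_C: "restrict g K \<in> C_on K" if "g \<in> ?N" for g
    using continuous_on_deep_narrow_mlps[OF continuous_on_poly[OF continuous_on_id] that, of K]
    by (simp add: C_on_def cong: continuous_on_cong)
  interpret M: Metric_space "mspace ?M" "mdist ?M" by (rule Metric_space_mspace_mdist)
  show ?thesis
  proof
    show "mtopology_of ?M closure_of ((\<lambda>f. restrict f K) ` ?N) \<subseteq> C_on K"
      using closure_of_subset_topspace[of "mtopology_of ?M"] by (simp only: topspace_mtopology_of space)
    show "C_on K \<subseteq> mtopology_of ?M closure_of ((\<lambda>f. restrict f K) ` ?N)"
    proof
      fix f :: "real ^ 'n \<Rightarrow> real ^ 'm" assume f: "f \<in> C_on K"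
      \<comment> \<open>Closed balls fit here: strict pointwise bounds by \<open>r\<close> yield
        only a non-strict bound for the supremum.\<close>
      have "\<exists>g\<in>(\<lambda>f. restrict f K) ` ?N. g \<in> M.mcball f r" if "r > 0" for r
      proof -
        obtain g where g: "g \<in> ?N" "\<And>x k. x \<in> K \<Longrightarrow> \<bar>g x $ k - f x $ k\<bar> < r"
          using deep_narrow_mlps_dense[of f r] f \<open>r > 0\<close> by (auto simp: C_on_def)
        have "mdist ?M f (restrict g K) \<le> r"
        proof (rule mdist_cfunspace_le)
          fix x assume "x \<in> topspace (top_of_set K)"
          then have x: "x \<in> K" by simp
          have "infnorm (f x - g x) \<le> r"
            using g(2)[OF x] by (intro infnorm_le_cart) (simp add: abs_minus_commute less_imp_le)
          then show "mdist infnorm_metric (f x) (restrict g K x) \<le> r" using x by simp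
        qed (use \<open>r > 0\<close> in simp)
        then have "restrict g K \<in> M.mcball f r"
          using f restrict_C[OF g(1)] unfolding M.in_mcball unfolding space by blast
        with g(1) show ?thesis by blast
      qed
      then show "f \<in> mtopology_of ?M closure_of ((\<lambda>f. restrict f K) ` ?N)"
        using f unfolding mtopology_of_def M.metric_closure_of_alt by (simp only: space) blast
    qed
  qed
qed

end
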